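(* Let $\mu$ be a measure on $\mathbb{R}^n$, and let $X$ be the Zariski closure of its support. Let $Y\subset\mathbb{R}^k$ be another affine real algebraic variety on which a compact group $G$ acts. Let $A$ and $B$ be the rings of complex-valued polynomials on $X$ and $Y$, and suppose that there is a ring isomorphism $$A\stackrel{\cong}{\longrightarrow}\mathrm{Inv}_G(B)$$ that doubles the filtration degree of $A$. Let $V$ be a unitary representation of $G$ and define the filtered vector space $$M=\mathrm{Inv}_G(B\otimes V).$$ If $F$ is a $t$-cubature formula for $\mu$, then $$|F|\ge\frac{\dim M_{\le t}}{\dim V}.$$
   Context: Measures are assumed to have finite moments and are normalized to total measure $1$. A $t$-cubature formula for $\mu$ is a finite set of points $F=\{p_a\}\subset\mathbb{R}^n$ with real weights $w_a$ such that $\int P\,d\mu=\sum_a w_aP(p_a)$ for all polynomials $P$ of degree at most $t$; $|F|$ is the number of points. The Zariski closure of a set is the smallest real algebraic variety containing it. The rings $A$ and $B$ are filtered by degree: $A_{\le d}$ (resp. $B_{\le d}$) consists of the restrictions to $X$ (resp. $Y$) of complex-valued polynomials of degree at most $d$ on $\mathbb{R}^n$ (resp. $\mathbb{R}^k$). $\mathrm{Inv}_G(\cdot)$ denotes the subspace of $G$-invariant elements, where $G$ acts on $B$ via its action on $Y$. "Doubles the filtration degree" means that $A_{\le d}$ corresponds to $\mathrm{Inv}_G(B)\cap B_{\le 2d}$. The filtration on $M$ is induced from that of $B$: $M_{\le d}=\mathrm{Inv}_G(B\otimes V)\cap(B_{\le d}\otimes V)$.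
   Formalization: Two hypotheses are added, without which the claim fails: the points of F lie in X, and each point x of the support of μ is the image of a real point y of Y under the isomorphism (φ(a)(y)=a(x) for all a in A). V is nonzero and finite-dimensional. *)

theory Defs
  imports
    "HOL-Probability.Probability"
    "HOL-Library.Function_Algebras"
    "HOL-Algebra.Group_Action"
    "HOL-Algebra.QuotRing"
begin

section \<open>Polynomial functions and real algebraic sets\<close>

definition monomial_fun :: "('n::finite \<Rightarrow> nat) \<Rightarrow> real ^ 'n \<Rightarrow> real" where
  "monomial_fun \<alpha> x = (\<Prod>i\<in>UNIV. (x $ i) ^ \<alpha> i)"

text \<open>The coefficients lie in \<^typ>\<open>real\<close> for real polynomials and in \<^typ>\<open>complex\<close> for
  complex-valued polynomials on real space.\<close>

definition poly_le :: "nat \<Rightarrow> (real ^ 'n::finite \<Rightarrow> 'a::real_vector) set" where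
  "poly_le d = {\<lambda>x. \<Sum>\<alpha> | (\<Sum>i\<in>UNIV. \<alpha> i) \<le> d. monomial_fun \<alpha> x *\<^sub>R c \<alpha> | c. True}"

definition algebraic_set :: "(real ^ 'n::finite) set \<Rightarrow> bool" where
  "algebraic_set Z \<longleftrightarrow>
     (\<exists>\<P> :: (real ^ 'n \<Rightarrow> real) set. \<P> \<subseteq> (\<Union>d. poly_le d) \<and> Z = {x. \<forall>P\<in>\<P>. P x = 0})"

definition zariski_closure :: "(real ^ 'n::finite) set \<Rightarrow> (real ^ 'n) set" where
  "zariski_closure S = algebraic_set hull S"


section \<open>The filtered ring of complex-valued polynomials on a set\<close>

text \<open>A function on \<open>X\<close> is represented by its extension by zero, so that sums, products and
  scalar multiples of functions on \<open>X\<close> are the pointwise ones.\<close>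

definition restr :: "'a set \<Rightarrow> ('a \<Rightarrow> 'b::zero) \<Rightarrow> 'a \<Rightarrow> 'b" where
  "restr X f = (\<lambda>x. if x \<in> X then f x else 0)"

definition coord_le :: "(real ^ 'n::finite) set \<Rightarrow> nat \<Rightarrow> (real ^ 'n \<Rightarrow> complex) set" where
  "coord_le X d = restr X ` poly_le d"

definition coord_ring :: "(real ^ 'n::finite) set \<Rightarrow> (real ^ 'n \<Rightarrow> complex) ring" where
  "coord_ring X =
     \<lparr>carrier = (\<Union>d. coord_le X d),
      mult = (\<lambda>f g x. f x * g x),
      one = restr X (\<lambda>x. 1),
      zero = (\<lambda>x. 0),
      add = (\<lambda>f g x. f x + g x)\<rparr>"


section \<open>Measures and cubature formulas\<close>

definition measure_support :: "'a::topological_space measure \<Rightarrow> 'a set" where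
  "measure_support \<mu> = {x. \<forall>U. open U \<and> x \<in> U \<longrightarrow> emeasure \<mu> U \<noteq> 0}"

definition normalized_measure_with_moments :: "(real ^ 'n::finite) measure \<Rightarrow> bool" where
  "normalized_measure_with_moments \<mu> \<longleftrightarrow>
     prob_space \<mu> \<and> sets \<mu> = sets borel \<and> (\<forall>\<alpha>. integrable \<mu> (monomial_fun \<alpha>))"

definition cubature_formula ::
    "nat \<Rightarrow> (real ^ 'n::finite) measure \<Rightarrow> (real ^ 'n) set \<Rightarrow> (real ^ 'n \<Rightarrow> real) \<Rightarrow> bool" where
  "cubature_formula t \<mu> F w \<longleftrightarrow>
     finite F \<and> (\<forall>P\<in>poly_le t. (LINT x|\<mu>. P x) = (\<Sum>p\<in>F. w p * P p))"


section \<open>Compact groups, their actions and unitary representations\<close>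

definition compact_group :: "('g, 'm) monoid_scheme \<Rightarrow> 'g topology \<Rightarrow> bool" where
  "compact_group G T \<longleftrightarrow>
     group G \<and> topspace T = carrier G \<and> compact_space T \<and> Hausdorff_space T \<and>
     continuous_map (prod_topology T T) T (\<lambda>(g, h). g \<otimes>\<^bsub>G\<^esub> h) \<and>
     continuous_map T T (\<lambda>g. inv\<^bsub>G\<^esub> g)"

text \<open>A continuous action on \<open>Y\<close> by polynomial maps; the latter is what makes \<open>G\<close> act on the
  ring of polynomials on \<open>Y\<close>.\<close>

definition algebraic_action ::
    "('g, 'm) monoid_scheme \<Rightarrow> 'g topology \<Rightarrow> (real ^ 'k::finite) set \<Rightarrow>
      ('g \<Rightarrow> real ^ 'k \<Rightarrow> real ^ 'k) \<Rightarrow> bool" where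
  "algebraic_action G T Y act \<longleftrightarrow>
     group_action G Y act \<and>
     continuous_map (prod_topology T (top_of_set Y)) (top_of_set Y) (\<lambda>(g, y). act g y) \<and>
     (\<forall>g\<in>carrier G. \<forall>i. \<exists>P\<in>(\<Union>d. poly_le d). \<forall>y\<in>Y. act g y $ i = P y)"

definition herm :: "complex ^ 'v::finite \<Rightarrow> complex ^ 'v \<Rightarrow> complex" where
  "herm u v = (\<Sum>i\<in>UNIV. u $ i * cnj (v $ i))"

text \<open>A finite-dimensional Hilbert space is \<^typ>\<open>complex ^ 'v\<close> in an orthonormal basis.\<close>

definition unitary_rep ::
    "('g, 'm) monoid_scheme \<Rightarrow> 'g topology \<Rightarrow> ('g \<Rightarrow> complex ^ 'v ^ 'v::finite) \<Rightarrow> bool" where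
  "unitary_rep G T \<rho> \<longleftrightarrow>
     \<rho> \<one>\<^bsub>G\<^esub> = mat 1 \<and>
     (\<forall>g\<in>carrier G. \<forall>h\<in>carrier G. \<rho> (g \<otimes>\<^bsub>G\<^esub> h) = \<rho> g ** \<rho> h) \<and>
     (\<forall>g\<in>carrier G. \<forall>u v. herm (\<rho> g *v u) (\<rho> g *v v) = herm u v) \<and>
     continuous_map T euclidean \<rho>"


section \<open>Invariants\<close>

definition inv_coord ::
    "('g, 'm) monoid_scheme \<Rightarrow> (real ^ 'k::finite) set \<Rightarrow> ('g \<Rightarrow> real ^ 'k \<Rightarrow> real ^ 'k) \<Rightarrow>
      (real ^ 'k \<Rightarrow> complex) set" where
  "inv_coord G Y act =
     {b \<in> carrier (coord_ring Y). \<forall>g\<in>carrier G. restr Y (\<lambda>y. b (act (inv\<^bsub>G\<^esub> g) y)) = b}"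

definition inv_ring ::
    "('g, 'm) monoid_scheme \<Rightarrow> (real ^ 'k::finite) set \<Rightarrow> ('g \<Rightarrow> real ^ 'k \<Rightarrow> real ^ 'k) \<Rightarrow>
      (real ^ 'k \<Rightarrow> complex) ring" where
  "inv_ring G Y act = (coord_ring Y)\<lparr>carrier := inv_coord G Y act\<rparr>"

definition fscale :: "complex \<Rightarrow> ('a \<Rightarrow> complex ^ 'v::finite) \<Rightarrow> 'a \<Rightarrow> complex ^ 'v" where
  "fscale c f = (\<lambda>y. c *s f y)"

global_interpretation fun_vec: vector_space "fscale :: complex \<Rightarrow> ('a \<Rightarrow> complex ^ 'v::finite) \<Rightarrow> _"
  by unfold_locales (auto simp: fscale_def fun_eq_iff vec_eq_iff algebra_simps)

text \<open>For a space \<open>U\<close> of complex-valued functions, \<open>U \<otimes> V\<close> is realised as the space of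
  \<open>V\<close>-valued functions spanned by the elementary tensors, \<open>b \<otimes> v\<close> being \<open>y \<mapsto> b(y) v\<close>.
  Under this identification the diagonal action of \<open>g\<close> sends \<open>f\<close> to
  \<open>y \<mapsto> \<rho>(g) f(g\<inverse> y)\<close>.\<close>

definition tensor_vec :: "('a \<Rightarrow> complex) set \<Rightarrow> ('a \<Rightarrow> complex ^ 'v::finite) set" where
  "tensor_vec U = fun_vec.span {\<lambda>y. b y *s v | b v. b \<in> U}"

definition inv_tensor ::
    "('g, 'm) monoid_scheme \<Rightarrow> (real ^ 'k::finite) set \<Rightarrow> ('g \<Rightarrow> real ^ 'k \<Rightarrow> real ^ 'k) \<Rightarrow>
      ('g \<Rightarrow> complex ^ 'v ^ 'v::finite) \<Rightarrow> (real ^ 'k \<Rightarrow> complex ^ 'v) set" where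
  "inv_tensor G Y act \<rho> =
     {f \<in> tensor_vec (carrier (coord_ring Y)).
        \<forall>g\<in>carrier G. restr Y (\<lambda>y. \<rho> g *v f (act (inv\<^bsub>G\<^esub> g) y)) = f}"

definition inv_tensor_le ::
    "('g, 'm) monoid_scheme \<Rightarrow> (real ^ 'k::finite) set \<Rightarrow> ('g \<Rightarrow> real ^ 'k \<Rightarrow> real ^ 'k) \<Rightarrow>
      ('g \<Rightarrow> complex ^ 'v ^ 'v::finite) \<Rightarrow> nat \<Rightarrow> (real ^ 'k \<Rightarrow> complex ^ 'v) set" where
  "inv_tensor_le G Y act \<rho> d = inv_tensor G Y act \<rho> \<inter> tensor_vec (coord_le Y d)"


section \<open>Filtered isomorphisms coming from a quotient map\<close>

definition doubles_filtration ::
    "('g, 'm) monoid_scheme \<Rightarrow> (real ^ 'n::finite) set \<Rightarrow> (real ^ 'k::finite) set \<Rightarrow>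
      ('g \<Rightarrow> real ^ 'k \<Rightarrow> real ^ 'k) \<Rightarrow>
      ((real ^ 'n \<Rightarrow> complex) \<Rightarrow> (real ^ 'k \<Rightarrow> complex)) \<Rightarrow> bool" where
  "doubles_filtration G X Y act \<phi> \<longleftrightarrow>
     (\<forall>d. \<phi> ` coord_le X d = inv_coord G Y act \<inter> coord_le Y (2 * d))"

text \<open>Every point of \<open>S\<close> is, through \<open>\<phi>\<close>, the image of a real point of \<open>Y\<close>. This is not
  automatic for a filtered ring isomorphism between coordinate rings: for \<open>Y = \<real>\<^sup>2\<close> with
  \<open>G = {1, -1}\<close> and the cone \<open>X = {(u, v, w). u w = v\<^sup>2}\<close>, the isomorphism
  \<open>u \<mapsto> y\<^sub>1\<^sup>2\<close>, \<open>v \<mapsto> y\<^sub>1 y\<^sub>2\<close>, \<open>w \<mapsto> y\<^sub>2\<^sup>2\<close> only reaches the nappe \<open>u, w \<ge> 0\<close>.\<close>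

definition points_lift ::
    "(real ^ 'n::finite) set \<Rightarrow> (real ^ 'n) set \<Rightarrow> (real ^ 'k::finite) set \<Rightarrow>
      ((real ^ 'n \<Rightarrow> complex) \<Rightarrow> (real ^ 'k \<Rightarrow> complex)) \<Rightarrow> bool" where
  "points_lift S X Y \<phi> \<longleftrightarrow>
     (\<forall>x\<in>S. \<exists>y\<in>Y. \<forall>a\<in>carrier (coord_ring X). \<phi> a y = a x)"

end

theory Submission
  imports Defs
begin

text \<open>For \<open>f, g \<in> M\<^sub>\<le>\<^sub>t\<close> the pointwise Hermitian product of \<open>f\<close> and \<open>g\<close> is an invariant polynomial of
  degree at most \<open>2t\<close> on \<open>Y\<close>, so it comes from a polynomial \<open>Q f g\<close> of degree at most \<open>t\<close> on \<open>X\<close>.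
  If \<open>Q f f\<close> vanishes on \<open>F\<close>, its integral is zero by the cubature formula; being nonnegative on the
  support, it vanishes there, hence on the Zariski closure \<open>X\<close>, and \<open>f = 0\<close>. At each
  point of \<open>F\<close> the form \<open>Q\<close> has rank at most \<open>dim V\<close>, even when that point does not lift to \<open>Y\<close>:
  its minors of size \<open>dim V + 1\<close> correspond to minors of Gram matrices, which are zero on \<open>Y\<close>. So at
  most \<open>|F| dim V\<close> linear functionals separate the points of \<open>M\<^sub>\<le>\<^sub>t\<close>.\<close>

section \<open>Spaces of polynomials\<close>

lemma finite_bounded_exponents: "finite {\<alpha>::'n::finite \<Rightarrow> nat. (\<Sum>i\<in>UNIV. \<alpha> i) \<le> d}"
proof (rule finite_subset)
  show "{\<alpha>::'n \<Rightarrow> nat. (\<Sum>i\<in>UNIV. \<alpha> i) \<le> d} \<subseteq> PiE UNIV (\<lambda>_. {..d})"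
  proof
    fix \<alpha> :: "'n \<Rightarrow> nat" assume "\<alpha> \<in> {\<alpha>. (\<Sum>i\<in>UNIV. \<alpha> i) \<le> d}"
    moreover have "\<alpha> i \<le> (\<Sum>i\<in>UNIV. \<alpha> i)" for i
      by (rule member_le_sum) auto
    ultimately show "\<alpha> \<in> PiE UNIV (\<lambda>_. {..d})"
      by (auto simp: PiE_def intro: order_trans)
  qed
qed (auto intro: finite_PiE)

lemma poly_leI:
  assumes "\<And>x. P x = (\<Sum>\<alpha> | (\<Sum>i\<in>UNIV. \<alpha> i) \<le> d. monomial_fun \<alpha> x *\<^sub>R c \<alpha>)"
  shows "P \<in> poly_le d"
  using assms by (auto simp: poly_le_def fun_eq_iff)

lemma poly_leE:
  assumes "P \<in> poly_le d"
  obtains c where "P = (\<lambda>x. \<Sum>\<alpha> | (\<Sum>i\<in>UNIV. \<alpha> i) \<le> d. monomial_fun \<alpha> x *\<^sub>R c \<alpha>)"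
  using assms by (auto simp: poly_le_def)

lemma poly_le_zero: "(\<lambda>x. 0) \<in> poly_le d"
  by (rule poly_leI[where c = "\<lambda>_. 0"]) simp

lemma poly_le_add:
  assumes "P \<in> poly_le d" "Q \<in> poly_le d"
  shows "(\<lambda>x. P x + Q x) \<in> poly_le d"
proof -
  obtain c where c: "P = (\<lambda>x. \<Sum>\<alpha> | (\<Sum>i\<in>UNIV. \<alpha> i) \<le> d. monomial_fun \<alpha> x *\<^sub>R c \<alpha>)"
    by (rule poly_leE[OF assms(1)])
  obtain c' where c': "Q = (\<lambda>x. \<Sum>\<alpha> | (\<Sum>i\<in>UNIV. \<alpha> i) \<le> d. monomial_fun \<alpha> x *\<^sub>R c' \<alpha>)"
    by (rule poly_leE[OF assms(2)])
  show ?thesis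
    by (rule poly_leI[where c = "\<lambda>\<alpha>. c \<alpha> + c' \<alpha>"]) (simp add: c c' scaleR_add_right sum.distrib)
qed

lemma poly_le_sum:
  assumes "\<And>i. i \<in> I \<Longrightarrow> P i \<in> poly_le d"
  shows "(\<lambda>x. \<Sum>i\<in>I. P i x) \<in> poly_le d"
  using assms by (induction I rule: infinite_finite_induct) (auto intro: poly_le_zero poly_le_add)

lemma monomial_in_poly_le:
  assumes "(\<Sum>i\<in>UNIV. \<alpha> i) \<le> d"
  shows "(\<lambda>x. monomial_fun \<alpha> x *\<^sub>R c) \<in> poly_le d"
proof (rule poly_leI[where c = "\<lambda>\<beta>. if \<beta> = \<alpha> then c else 0"])
  fix x :: "real ^ 'a"
  have "(\<Sum>\<beta> | (\<Sum>i\<in>UNIV. \<beta> i) \<le> d. monomial_fun \<beta> x *\<^sub>R (if \<beta> = \<alpha> then c else 0)) =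
    (\<Sum>\<beta> | (\<Sum>i\<in>UNIV. \<beta> i) \<le> d. if \<beta> = \<alpha> then monomial_fun \<alpha> x *\<^sub>R c else 0)"
    by (rule sum.cong) auto
  then show "monomial_fun \<alpha> x *\<^sub>R c =
    (\<Sum>\<beta> | (\<Sum>i\<in>UNIV. \<beta> i) \<le> d. monomial_fun \<beta> x *\<^sub>R (if \<beta> = \<alpha> then c else 0))"
    using assms by (simp add: sum.delta finite_bounded_exponents)
qed

lemma poly_le_mono:
  assumes "d \<le> e" "P \<in> poly_le d"
  shows "P \<in> poly_le e"
proof -
  obtain c where c: "P = (\<lambda>x. \<Sum>\<alpha> | (\<Sum>i\<in>UNIV. \<alpha> i) \<le> d. monomial_fun \<alpha> x *\<^sub>R c \<alpha>)"
    by (rule poly_leE[OF assms(2)])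
  have "(\<lambda>x. \<Sum>\<alpha> | (\<Sum>i\<in>UNIV. \<alpha> i) \<le> d. monomial_fun \<alpha> x *\<^sub>R c \<alpha>) \<in> poly_le e"
    using assms(1) by (intro poly_le_sum monomial_in_poly_le) auto
  then show ?thesis unfolding c .
qed

lemma monomial_fun_mult:
  "monomial_fun \<alpha> x * monomial_fun \<beta> x = monomial_fun (\<lambda>i. \<alpha> i + \<beta> i) x"
  by (simp add: monomial_fun_def prod.distrib power_add)

lemma poly_le_mult:
  fixes P Q :: "real ^ 'n::finite \<Rightarrow> 'a::real_algebra"
  assumes "P \<in> poly_le d" "Q \<in> poly_le e"
  shows "(\<lambda>x. P x * Q x) \<in> poly_le (d + e)"
proof -
  obtain c where c: "P = (\<lambda>x. \<Sum>\<alpha> | (\<Sum>i\<in>UNIV. \<alpha> i) \<le> d. monomial_fun \<alpha> x *\<^sub>R c \<alpha>)"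
    by (rule poly_leE[OF assms(1)])
  obtain c' where c': "Q = (\<lambda>x. \<Sum>\<alpha> | (\<Sum>i\<in>UNIV. \<alpha> i) \<le> e. monomial_fun \<alpha> x *\<^sub>R c' \<alpha>)"
    by (rule poly_leE[OF assms(2)])
  have "(\<lambda>x. \<Sum>\<alpha> | (\<Sum>i\<in>UNIV. \<alpha> i) \<le> d. \<Sum>\<beta> | (\<Sum>i\<in>UNIV. \<beta> i) \<le> e.
      monomial_fun (\<lambda>i. \<alpha> i + \<beta> i) x *\<^sub>R (c \<alpha> * c' \<beta>)) \<in> poly_le (d + e)"
    by (intro poly_le_sum monomial_in_poly_le) (auto simp: sum.distrib intro: add_mono)
  moreover have "P x * Q x = (\<Sum>\<alpha> | (\<Sum>i\<in>UNIV. \<alpha> i) \<le> d. \<Sum>\<beta> | (\<Sum>i\<in>UNIV. \<beta> i) \<le> e.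
      monomial_fun (\<lambda>i. \<alpha> i + \<beta> i) x *\<^sub>R (c \<alpha> * c' \<beta>))" for x
    by (simp add: c c' sum_product mult.commute flip: monomial_fun_mult)
  ultimately show ?thesis by simp
qed

text \<open>A real-linear map acts on the coefficients alone. This covers real and imaginary parts,
  complex conjugation and multiplication by a complex constant.\<close>

lemma poly_le_linear:
  assumes "linear h" "P \<in> poly_le d"
  shows "(\<lambda>x. h (P x)) \<in> poly_le d"
proof -
  obtain c where c: "P = (\<lambda>x. \<Sum>\<alpha> | (\<Sum>i\<in>UNIV. \<alpha> i) \<le> d. monomial_fun \<alpha> x *\<^sub>R c \<alpha>)"
    by (rule poly_leE[OF assms(2)])
  show ?thesis
    by (rule poly_leI[where c = "\<lambda>\<alpha>. h (c \<alpha>)"])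
      (simp add: c linear_sum[OF assms(1)] linear_cmul[OF assms(1)])
qed

lemma poly_le_const: "(\<lambda>x. c) \<in> poly_le d"
  using monomial_in_poly_le[of "\<lambda>_. 0" d c] by (simp add: monomial_fun_def)

text \<open>The zero exponent is the only one of total degree 0. This will identify the images of
  constants under the filtered isomorphism.\<close>

lemma poly_le_0_constant:
  assumes "P \<in> poly_le 0"
  obtains c where "P = (\<lambda>x. c)"
proof -
  obtain c where c: "P = (\<lambda>x. \<Sum>\<alpha> | (\<Sum>i\<in>UNIV. \<alpha> i) \<le> 0. monomial_fun \<alpha> x *\<^sub>R c \<alpha>)"
    by (rule poly_leE[OF assms])
  have "{\<alpha>::'a \<Rightarrow> nat. (\<Sum>i\<in>UNIV. \<alpha> i) \<le> 0} = {\<lambda>_. 0}"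
    by (auto simp: fun_eq_iff)
  then have "P = (\<lambda>x. c (\<lambda>_. 0))"
    by (simp add: c monomial_fun_def)
  then show ?thesis by (rule that)
qed

lemma continuous_on_poly_le:
  fixes P :: "real ^ 'n::finite \<Rightarrow> 'a::real_normed_vector"
  assumes "P \<in> poly_le d"
  shows "continuous_on UNIV P"
proof -
  obtain c where c: "P = (\<lambda>x. \<Sum>\<alpha> | (\<Sum>i\<in>UNIV. \<alpha> i) \<le> d. monomial_fun \<alpha> x *\<^sub>R c \<alpha>)"
    by (rule poly_leE[OF assms])
  show ?thesis
    unfolding c monomial_fun_def by (intro continuous_intros)
qed

lemma integrable_poly_le:
  fixes P :: "real ^ 'n::finite \<Rightarrow> real"
  assumes "normalized_measure_with_moments \<mu>" "P \<in> poly_le d"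
  shows "integrable \<mu> P"
proof -
  obtain c where c: "P = (\<lambda>x. \<Sum>\<alpha> | (\<Sum>i\<in>UNIV. \<alpha> i) \<le> d. monomial_fun \<alpha> x *\<^sub>R c \<alpha>)"
    by (rule poly_leE[OF assms(2)])
  have "integrable \<mu> (\<lambda>x. \<Sum>\<alpha> | (\<Sum>i\<in>UNIV. \<alpha> i) \<le> d. monomial_fun \<alpha> x *\<^sub>R c \<alpha>)"
    using assms(1) by (intro Bochner_Integration.integrable_sum integrable_scaleR_left)
      (auto simp: normalized_measure_with_moments_def)
  then show ?thesis unfolding c .
qed


section \<open>Zariski closure and support of a measure\<close>

lemma zariski_closure_superset: "S \<subseteq> zariski_closure S"
  by (simp add: zariski_closure_def hull_subset)

text \<open>The zero set of \<open>P\<close> is one of the algebraic sets containing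
  \<open>S\<close>, so the hull lies inside it.\<close>

lemma poly_vanishes_on_zariski_closure:
  fixes P :: "real ^ 'n::finite \<Rightarrow> real"
  assumes "P \<in> poly_le d" "\<And>x. x \<in> S \<Longrightarrow> P x = 0" "x \<in> zariski_closure S"
  shows "P x = 0"
proof -
  have "algebraic_set {x. P x = 0}"
    unfolding algebraic_set_def using assms(1) by (intro exI[of _ "{P}"]) auto
  then have "zariski_closure S \<subseteq> {x. P x = 0}"
    unfolding zariski_closure_def using assms(2) by (intro hull_minimal) auto
  then show ?thesis using assms(3) by auto
qed

text \<open>The complement of the support is covered by the null members of a countable basis, and a
  countable union of null sets is null.\<close>

lemma AE_in_measure_support:
  fixes \<mu> :: "'a::second_countable_topology measure"
  assumes "sets \<mu> = sets borel"
  shows "AE x in \<mu>. x \<in> measure_support \<mu>"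
proof -
  obtain B :: "'a set set" where B: "countable B" "topological_basis B"
    using ex_countable_basis by blast
  let ?N = "\<Union>{U\<in>B. emeasure \<mu> U = 0}"
  have "?N \<in> null_sets \<mu>"
    using B by (intro null_sets_UN'[where N = "\<lambda>U. U" and I = "{U\<in>B. emeasure \<mu> U = 0}", simplified])
      (auto simp: null_sets_def assms topological_basis_open)
  moreover have "x \<in> measure_support \<mu>" if "x \<notin> ?N" for x
    unfolding measure_support_def
  proof safe
    fix U assume U: "open U" "x \<in> U" "emeasure \<mu> U = 0"
    obtain V where V: "V \<in> B" "x \<in> V" "V \<subseteq> U"
      using topological_basisE[OF B(2) U(1,2)] by blast
    have "emeasure \<mu> V \<le> emeasure \<mu> U"
      using V(3) U(1) by (intro emeasure_mono) (auto simp: assms)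
    then show False using U(3) V that by auto
  qed
  ultimately show ?thesis
    by (auto intro: AE_I'[where N = ?N])
qed

text \<open>Supplies the lifting point that pins down the images of constants.\<close>

lemma measure_support_nonempty:
  fixes \<mu> :: "'a::second_countable_topology measure"
  assumes "prob_space \<mu>" "sets \<mu> = sets borel"
  shows "measure_support \<mu> \<noteq> {}"
  using AE_in_measure_support[OF assms(2)] prob_space.AE_False[OF assms(1)] by auto

text \<open>A function that is nonnegative almost everywhere and has integral zero vanishes almost
  everywhere. Its nonvanishing set is then null and, by continuity, open, so it misses the
  support.\<close>

lemma integral_eq_zero_imp_vanishes_on_support:
  fixes P :: "real ^ 'n::finite \<Rightarrow> real"
  assumes \<mu>: "normalized_measure_with_moments \<mu>"
    and P: "P \<in> poly_le d" "\<And>x. x \<in> measure_support \<mu> \<Longrightarrow> 0 \<le> P x"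
    and int: "(LINT x|\<mu>. P x) = 0"
    and x: "x \<in> measure_support \<mu>"
  shows "P x = 0"
proof (rule ccontr)
  assume "P x \<noteq> 0"
  have sets: "sets \<mu> = sets borel"
    using \<mu> by (simp add: normalized_measure_with_moments_def)
  have "AE x in \<mu>. 0 \<le> P x"
    using AE_in_measure_support[OF sets] by eventually_elim (rule P)
  then have "AE x in \<mu>. P x = 0"
    using integral_nonneg_eq_0_iff_AE[OF integrable_poly_le[OF \<mu> P(1)]] int by simp
  moreover have op: "open {x. P x \<noteq> 0}"
    using continuous_on_poly_le[OF P(1)] by (intro open_Collect_neq continuous_intros) auto
  ultimately have "emeasure \<mu> {x. P x \<noteq> 0} = 0"
    using sets sets_eq_imp_space_eq[OF sets] by (subst (asm) AE_iff_null) (auto simp: null_sets_def)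
  with op \<open>P x \<noteq> 0\<close> x show False
    by (auto simp: measure_support_def)
qed


section \<open>Linear algebra\<close>

text \<open>The spanning set is built without assuming finite dimension: each functional that does not
  vanish on \<open>W\<close> costs one spanning vector, on which it does not vanish.\<close>

lemma (in vector_space) spanned_by_card_separating_functionals:
  assumes "finite J" "subspace W"
    and "\<And>j x y. j \<in> J \<Longrightarrow> x \<in> W \<Longrightarrow> y \<in> W \<Longrightarrow> l j (x + y) = l j x + l j y"
    and "\<And>j c x. j \<in> J \<Longrightarrow> x \<in> W \<Longrightarrow> l j (scale c x) = c * l j x"
    and "\<And>x. x \<in> W \<Longrightarrow> (\<And>j. j \<in> J \<Longrightarrow> l j x = 0) \<Longrightarrow> x = 0"
  shows "\<exists>S. finite S \<and> card S \<le> card J \<and> W \<subseteq> span S"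
  using assms
proof (induction J arbitrary: W rule: finite_induct)
  case empty
  then show ?case by (intro exI[of _ "{}"]) auto
next
  case (insert j J)
  have add: "l j (x + y) = l j x + l j y" if "x \<in> W" "y \<in> W" for x y
    using insert.prems(2) that by simp
  have scale: "l j (scale c x) = c * l j x" if "x \<in> W" for c x
    using insert.prems(3) that by simp
  have zero: "l j 0 = 0"
    using scale[of 0 0] insert.prems(1) by (simp add: subspace_0)
  \<comment> \<open>On the kernel of \<open>l j\<close> the remaining functionals still separate
    points, so the induction hypothesis applies to \<open>?K\<close>.\<close>
  let ?K = "{x\<in>W. l j x = 0}"
  have "\<exists>S. finite S \<and> card S \<le> card J \<and> ?K \<subseteq> span S"
  proof (rule insert.IH)
    show "subspace ?K"
      using insert.prems(1) by (auto simp: subspace_def add scale zero)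
  next
    fix x assume "x \<in> ?K" "\<And>i. i \<in> J \<Longrightarrow> l i x = 0"
    then show "x = 0"
      using insert.prems(4)[of x] by blast
  qed (use insert.prems(2,3) in simp_all)
  then obtain S where S: "finite S" "card S \<le> card J" "?K \<subseteq> span S"
    by blast
  show ?case
  proof (cases "?K = W")
    case True
    then show ?thesis using S insert.hyps by (intro exI[of _ S]) auto
  next
    case False
    then obtain u where u: "u \<in> W" "l j u \<noteq> 0" by auto
    have "x \<in> span (insert u S)" if x: "x \<in> W" for x
    proof -
      \<comment> \<open>\<open>v\<close> is the multiple of \<open>u\<close> that cancels the value
        of \<open>l j\<close> at \<open>x\<close>.\<close>
      define v where "v = scale (- (l j x / l j u)) u"
      have "v \<in> W" "l j v = - l j x"
        using u insert.prems(1) by (simp_all only: v_def scale subspace_scale) simp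
      then have "x + v \<in> ?K"
        using x insert.prems(1) by (simp add: add subspace_add)
      then have "x + v \<in> span (insert u S)"
        using S(3) span_mono[of S "insert u S"] by blast
      moreover have "v \<in> span (insert u S)"
        unfolding v_def by (intro span_scale span_base) simp
      ultimately have "x + v - v \<in> span (insert u S)"
        by (rule span_diff)
      then show ?thesis by simp
    qed
    moreover have "card (insert u S) \<le> card (insert j J)"
      using S insert.hyps by (simp add: card_insert_if)
    ultimately show ?thesis
      using S(1) by (intro exI[of _ "insert u S"]) auto
  qed
qed

text \<open>No order on the index type is available, so triangularity is expressed through an
  injection \<open>h\<close> into the natural numbers.\<close>

lemma det_triangular_neq_0:
  fixes A :: "'a::field ^ 'n::finite ^ 'n" and h :: "'n \<Rightarrow> nat"
  assumes "inj h" "\<And>i. A $ i $ i \<noteq> 0" "\<And>i j. h i < h j \<Longrightarrow> A $ i $ j = 0"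
  shows "det A \<noteq> 0"
proof -
  have "x = 0" if Ax: "A *v x = 0" for x
  proof -
    have "x $ i = 0" for i
    proof (induction "h i" arbitrary: i rule: less_induct)
      case less
      \<comment> \<open>Forward substitution: unknowns of smaller \<open>h\<close> vanish by
        induction and entries of larger \<open>h\<close> by triangularity, so only the diagonal term
        survives.\<close>
      have "A $ i $ j * x $ j = (if j = i then A $ i $ i * x $ i else 0)" for j
        using less[of j] assms(3)[of i j] injD[OF assms(1), of i j]
        by (cases "h i" "h j" rule: linorder_cases) auto
      then have "(\<Sum>j\<in>UNIV. A $ i $ j * x $ j) = (\<Sum>j\<in>UNIV. if j = i then A $ i $ i * x $ i else 0)"
        by (rule sum.cong[OF refl])
      then have "(A *v x) $ i = A $ i $ i * x $ i"
        by (simp add: matrix_vector_mult_def)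
      then show ?case using Ax assms(2)[of i] by simp
    qed
    then show ?thesis by (simp add: vec_eq_iff)
  qed
  then show ?thesis
    by (simp flip: invertible_det_nz add: invertible_left_inverse matrix_left_invertible_ker)
qed

text \<open>If no such \<open>S\<close> existed, pairs \<open>f i\<close>, \<open>g i\<close> could
  be chosen greedily until they form a triangular matrix of size \<open>CARD('v) + 1\<close> with
  nonzero diagonal, which is a nonzero minor. The type \<open>'v option\<close> provides the one
  extra index.\<close>

lemma finite_rank_of_vanishing_minors:
  fixes \<beta> :: "'b \<Rightarrow> 'b \<Rightarrow> 'a::field"
  assumes minors: "\<And>f g :: 'v::finite option \<Rightarrow> 'b. range f \<subseteq> W \<Longrightarrow> range g \<subseteq> W \<Longrightarrow>
      det (\<chi> i j. \<beta> (f i) (g j)) = 0"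
  shows "\<exists>S. S \<subseteq> W \<and> finite S \<and> card S \<le> CARD('v) \<and>
    (\<forall>f\<in>W. (\<forall>g\<in>S. \<beta> f g = 0) \<longrightarrow> (\<forall>g\<in>W. \<beta> f g = 0))"
proof (rule ccontr)
  assume no: "\<not> ?thesis"
  have "\<exists>f g. (\<forall>i<n. f i \<in> W \<and> g i \<in> W \<and> \<beta> (f i) (g i) \<noteq> 0) \<and>
    (\<forall>i j. i < j \<and> j < n \<longrightarrow> \<beta> (f j) (g i) = 0)" if "n \<le> Suc CARD('v)" for n :: nat
    using that
  proof (induction n)
    case (Suc n)
    then obtain f g where fg: "\<And>i. i < n \<Longrightarrow> f i \<in> W \<and> g i \<in> W \<and> \<beta> (f i) (g i) \<noteq> 0"
        "\<And>i j. i < j \<Longrightarrow> j < n \<Longrightarrow> \<beta> (f j) (g i) = 0"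
      by (metis Suc_leD)
    \<comment> \<open>At most \<open>CARD('v)\<close> elements \<open>g i\<close> have been chosen,
      so their set is a candidate for \<open>S\<close>. Its failure yields an \<open>f'\<close> that
      kills all of them but not some \<open>g'\<close>.\<close>
    have "card (g ` {..<n}) \<le> CARD('v)"
      using card_image_le[of "{..<n}" g] Suc.prems by simp
    then obtain f' g' where "f' \<in> W" "g' \<in> W" "\<beta> f' g' \<noteq> 0" "\<And>i. i < n \<Longrightarrow> \<beta> f' (g i) = 0"
      using no fg(1) by (auto dest!: spec[of _ "g ` {..<n}"])
    then show ?case
      using fg by (intro exI[of _ "f(n := f')"] exI[of _ "g(n := g')"]) (auto simp: less_Suc_eq)
  qed simp
  from this[OF order_refl] obtain f g where fg: "\<And>i. i < Suc CARD('v) \<Longrightarrow> f i \<in> W \<and> g i \<in> W \<and> \<beta> (f i) (g i) \<noteq> 0"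
      "\<And>i j. i < j \<Longrightarrow> j < Suc CARD('v) \<Longrightarrow> \<beta> (f j) (g i) = 0"
    by blast
  obtain h :: "'v option \<Rightarrow> nat" where h: "bij_betw h UNIV {0..<Suc CARD('v)}"
    using ex_bij_betw_finite_nat[of "UNIV :: 'v option set"] by (auto simp: card_UNIV_option)
  have h_less: "h i < Suc CARD('v)" for i
    using bij_betwE[OF h] by auto
  \<comment> \<open>The vanishing entries pair a later \<open>f\<close> with an earlier
    \<open>g\<close>. Indexing rows by \<open>g\<close> and columns by \<open>f\<close> puts them
    where \<open>det_triangular_neq_0\<close> expects zeros; the transpose undoes this
    below.\<close>
  let ?A = "\<chi> i j. \<beta> (f (h j)) (g (h i))"
  have "det ?A \<noteq> 0"
    using fg h h_less by (intro det_triangular_neq_0[where h = h]) (auto simp: bij_betw_def)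
  moreover have "det ?A = det (\<chi> i j. \<beta> (f (h i)) (g (h j)))"
    by (subst det_transpose[symmetric]) (simp add: transpose_def)
  moreover have "det (\<chi> i j. \<beta> (f (h i)) (g (h j))) = 0"
    using minors[of "\<lambda>i. f (h i)" "\<lambda>i. g (h i)"] fg(1) h_less by auto
  ultimately show False by simp
qed

text \<open>The Gram matrix factors through a square matrix padded with a zero row.\<close>

lemma det_herm_eq_0:
  fixes f g :: "'v::finite option \<Rightarrow> complex ^ 'v"
  shows "det (\<chi> i j. herm (f i) (g j)) = 0"
proof -
  define A :: "complex ^ 'v option ^ 'v option" where
    "A = (\<chi> i k. case k of None \<Rightarrow> 0 | Some v \<Rightarrow> f i $ v)"
  define B :: "complex ^ 'v option ^ 'v option" where
    "B = (\<chi> k j. case k of None \<Rightarrow> 0 | Some v \<Rightarrow> cnj (g j $ v))"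
  have "(\<chi> i j. herm (f i) (g j)) = A ** B"
    by (simp add: A_def B_def matrix_matrix_mult_def herm_def vec_eq_iff UNIV_option_conv
        sum.reindex)
  moreover have prod: "(\<Prod>i\<in>UNIV. B $ i $ p i) = 0" for p
    by (rule prod_zero) (auto simp: B_def intro!: exI[of _ None])
  have "det B = 0"
    unfolding det_def prod by simp
  ultimately show ?thesis by (simp add: det_mul)
qed

lemma herm_add_left: "herm (u + u') v = herm u v + herm u' v"
  by (simp add: herm_def algebra_simps sum.distrib)

lemma herm_scale_left: "herm (c *s u) v = c * herm u v"
  by (simp add: herm_def sum_distrib_left algebra_simps)

lemma herm_self: "herm u u = of_real (\<Sum>i\<in>UNIV. (cmod (u $ i))\<^sup>2)"
  by (simp add: herm_def complex_norm_square del: of_real_power)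

lemma herm_self_eq_0: "herm u u = 0 \<longleftrightarrow> u = 0"
  unfolding herm_self of_real_eq_0_iff by (simp add: sum_nonneg_eq_0_iff vec_eq_iff)


section \<open>Coordinate rings and tensors\<close>

lemma coord_leE:
  assumes "a \<in> coord_le X d"
  obtains P where "P \<in> poly_le d" "a = restr X P"
  using assms by (auto simp: coord_le_def)

lemma coord_le_zero_outside: "a \<in> coord_le X d \<Longrightarrow> x \<notin> X \<Longrightarrow> a x = 0"
  by (auto simp: coord_le_def restr_def)

lemma coord_le_mono:
  assumes "d \<le> e"
  shows "coord_le X d \<subseteq> coord_le X e"
  unfolding coord_le_def using poly_le_mono[OF assms] by blast

lemma coord_le_const: "restr X (\<lambda>x. c) \<in> coord_le X d"
  by (auto simp: coord_le_def poly_le_const)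

lemma coord_le_add:
  assumes "a \<in> coord_le X d" "b \<in> coord_le X d"
  shows "(\<lambda>x. a x + b x) \<in> coord_le X d"
proof -
  obtain P Q where "P \<in> poly_le d" "a = restr X P" "Q \<in> poly_le d" "b = restr X Q"
    using assms by (meson coord_leE)
  then show ?thesis
    unfolding coord_le_def
    by (intro image_eqI[where x = "\<lambda>x. P x + Q x"]) (auto simp: restr_def intro: poly_le_add)
qed

lemma coord_le_mult:
  assumes "a \<in> coord_le X d" "b \<in> coord_le X e"
  shows "(\<lambda>x. a x * b x) \<in> coord_le X (d + e)"
proof -
  obtain P Q where "P \<in> poly_le d" "a = restr X P" "Q \<in> poly_le e" "b = restr X Q"
    using assms by (meson coord_leE)
  then show ?thesis
    unfolding coord_le_def
    by (intro image_eqI[where x = "\<lambda>x. P x * Q x"]) (auto simp: restr_def intro: poly_le_mult)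
qed

lemma coord_le_linear:
  assumes "a \<in> coord_le X d" "linear h"
  shows "(\<lambda>x. h (a x)) \<in> coord_le X d"
proof -
  obtain P where "P \<in> poly_le d" "a = restr X P"
    using assms(1) by (rule coord_leE)
  then show ?thesis
    unfolding coord_le_def using linear_0[OF assms(2)]
    by (intro image_eqI[where x = "\<lambda>x. h (P x)"])
      (auto simp: restr_def fun_eq_iff intro: poly_le_linear[OF assms(2)])
qed

lemma coord_le_zero: "(\<lambda>x. 0) \<in> coord_le X d"
  using coord_le_const[of X 0 d] by (simp add: restr_def)

lemma coord_le_sum:
  assumes "\<And>i. i \<in> I \<Longrightarrow> a i \<in> coord_le X d"
  shows "(\<lambda>x. \<Sum>i\<in>I. a i x) \<in> coord_le X d"
  using assms by (induction I rule: infinite_finite_induct) (auto intro: coord_le_zero coord_le_add)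

lemma coord_ring_carrier: "a \<in> carrier (coord_ring X) \<longleftrightarrow> (\<exists>d. a \<in> coord_le X d)"
  by (simp add: coord_ring_def)

lemma coord_ring_add_closed:
  assumes "a \<in> carrier (coord_ring X)" "b \<in> carrier (coord_ring X)"
  shows "(\<lambda>x. a x + b x) \<in> carrier (coord_ring X)"
proof -
  obtain d e where "a \<in> coord_le X d" "b \<in> coord_le X e"
    using assms by (auto simp: coord_ring_carrier)
  then have "a \<in> coord_le X (max d e)" "b \<in> coord_le X (max d e)"
    using coord_le_mono[of d "max d e"] coord_le_mono[of e "max d e"] by auto
  then show ?thesis
    using coord_le_add coord_ring_carrier by blast
qed

lemma coord_ring_mult_closed:
  assumes "a \<in> carrier (coord_ring X)" "b \<in> carrier (coord_ring X)"
  shows "(\<lambda>x. a x * b x) \<in> carrier (coord_ring X)"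
  using assms coord_le_mult unfolding coord_ring_carrier by blast

text \<open>The components of an elementary tensor are scalar multiples of its function factor, and
  \<open>coord_le Y d\<close> is closed under linear combinations.\<close>

lemma tensor_vec_component:
  assumes "f \<in> tensor_vec (coord_le Y d)"
  shows "(\<lambda>y. f y $ i) \<in> coord_le Y d"
  using assms unfolding tensor_vec_def
proof (induction rule: fun_vec.span_induct_alt)
  case base
  then show ?case by (simp add: coord_le_zero)
next
  case (step c x f)
  then obtain b v where b: "x = (\<lambda>y. b y *s v)" "b \<in> coord_le Y d" by auto
  have "linear (\<lambda>z. c * (z * v $ i))"
    by (auto intro!: linearI simp: algebra_simps)
  from coord_le_add[OF coord_le_linear[OF b(2) this] step(2)] show ?case
    by (simp add: b(1) fscale_def mult.assoc)
qed

text \<open>Conjugation preserves the degree because the variables are real, and the degrees of the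
  two factors add.\<close>

lemma herm_in_coord_le:
  assumes "f \<in> tensor_vec (coord_le Y d)" "g \<in> tensor_vec (coord_le Y e)"
  shows "(\<lambda>y. herm (f y) (g y)) \<in> coord_le Y (d + e)"
proof -
  have "linear cnj"
    by (rule bounded_linear.linear) (rule bounded_linear_cnj)
  then show ?thesis
    unfolding herm_def
    by (intro coord_le_sum coord_le_mult coord_le_linear[where h = cnj] tensor_vec_component assms)
qed

lemma restr_eq_iff: "restr Y h = f \<longleftrightarrow> (\<forall>y. (y \<in> Y \<longrightarrow> h y = f y) \<and> (y \<notin> Y \<longrightarrow> f y = 0))"
  by (auto simp: restr_def fun_eq_iff)

text \<open>Two spans are intersected with the solution set of linear invariance equations.\<close>

lemma subspace_inv_tensor_le: "fun_vec.subspace (inv_tensor_le G Y act \<rho> d)"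
proof -
  have "fun_vec.subspace {f. \<forall>g\<in>carrier G. restr Y (\<lambda>y. \<rho> g *v f (act (inv\<^bsub>G\<^esub> g) y)) = f}"
    unfolding fun_vec.subspace_def restr_eq_iff
    by (auto simp: fscale_def matrix_vector_right_distrib vector_scalar_commute)
  then have "fun_vec.subspace (tensor_vec (carrier (coord_ring Y)) \<inter>
      {f. \<forall>g\<in>carrier G. restr Y (\<lambda>y. \<rho> g *v f (act (inv\<^bsub>G\<^esub> g) y)) = f} \<inter>
      tensor_vec (coord_le Y d))"
    unfolding tensor_vec_def by (intro fun_vec.subspace_inter fun_vec.subspace_span)
  then show ?thesis
    by (simp add: inv_tensor_le_def inv_tensor_def Collect_conj_eq)
qed

text \<open>Invariance writes \<open>f y\<close> and \<open>h y\<close> as the images under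
  \<open>\<rho> g\<close> of the values at the translated point; unitarity then removes
  \<open>\<rho> g\<close> from the product.\<close>

lemma herm_inv_coord:
  assumes \<rho>: "unitary_rep G T \<rho>"
    and f: "f \<in> inv_tensor_le G Y act \<rho> d" and h: "h \<in> inv_tensor_le G Y act \<rho> e"
  shows "(\<lambda>y. herm (f y) (h y)) \<in> inv_coord G Y act \<inter> coord_le Y (d + e)"
proof -
  have mem: "(\<lambda>y. herm (f y) (h y)) \<in> coord_le Y (d + e)"
    using f h by (intro herm_in_coord_le) (auto simp: inv_tensor_le_def)
  have "restr Y (\<lambda>y. herm (f (act (inv\<^bsub>G\<^esub> g) y)) (h (act (inv\<^bsub>G\<^esub> g) y))) y = herm (f y) (h y)"
    if g: "g \<in> carrier G" for g y
  proof (cases "y \<in> Y")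
    case True
    have "restr Y (\<lambda>y. \<rho> g *v f (act (inv\<^bsub>G\<^esub> g) y)) y = f y"
      "restr Y (\<lambda>y. \<rho> g *v h (act (inv\<^bsub>G\<^esub> g) y)) y = h y"
      using f h g by (auto simp: inv_tensor_le_def inv_tensor_def)
    then have "f y = \<rho> g *v f (act (inv\<^bsub>G\<^esub> g) y)" "h y = \<rho> g *v h (act (inv\<^bsub>G\<^esub> g) y)"
      using True by (auto simp: restr_def)
    then have "herm (f y) (h y) =
        herm (\<rho> g *v f (act (inv\<^bsub>G\<^esub> g) y)) (\<rho> g *v h (act (inv\<^bsub>G\<^esub> g) y))"
      by argo
    also have "\<dots> = herm (f (act (inv\<^bsub>G\<^esub> g) y)) (h (act (inv\<^bsub>G\<^esub> g) y))"
      using \<rho> g by (simp add: unitary_rep_def)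
    finally show ?thesis using True by (simp add: restr_def)
  next
    case False
    then show ?thesis
      using coord_le_zero_outside[OF mem] by (simp add: restr_def)
  qed
  then show ?thesis
    using mem by (auto simp: inv_coord_def coord_ring_carrier fun_eq_iff)
qed


section \<open>Transport along the isomorphism\<close>

text \<open>\<open>S\<close> is the set of points that lift to \<open>Y\<close>; it will be the
  support of \<mu>.\<close>

locale filtered_invariant_iso =
  fixes S X :: "(real ^ 'n::finite) set" and Y :: "(real ^ 'k::finite) set"
    and G :: "('g, 'm) monoid_scheme" and act :: "'g \<Rightarrow> real ^ 'k \<Rightarrow> real ^ 'k"
    and \<phi> :: "(real ^ 'n \<Rightarrow> complex) \<Rightarrow> (real ^ 'k \<Rightarrow> complex)"
  assumes S_subset: "S \<subseteq> X" and S_nonempty: "S \<noteq> {}"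
    and iso: "\<phi> \<in> ring_iso (coord_ring X) (inv_ring G Y act)"
    and doubles: "doubles_filtration G X Y act \<phi>"
    and lift: "points_lift S X Y \<phi>"
begin

text \<open>Correspondence under \<open>\<phi>\<close> of functions that matter only on
  \<open>X\<close> and on \<open>Y\<close>. Ignoring values elsewhere lets polynomials and
  determinants be used without extending them by zero.\<close>

definition transported :: "(real ^ 'n \<Rightarrow> complex) \<Rightarrow> (real ^ 'k \<Rightarrow> complex) \<Rightarrow> bool" where
  "transported u v \<longleftrightarrow>
     (\<exists>a\<in>carrier (coord_ring X). (\<forall>x\<in>X. a x = u x) \<and> (\<forall>y\<in>Y. \<phi> a y = v y))"

lemma hom_add:
  "a \<in> carrier (coord_ring X) \<Longrightarrow> b \<in> carrier (coord_ring X) \<Longrightarrow>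
    \<phi> (\<lambda>x. a x + b x) = (\<lambda>y. \<phi> a y + \<phi> b y)"
  using iso by (auto simp: ring_iso_def ring_hom_def coord_ring_def inv_ring_def)

lemma hom_mult:
  "a \<in> carrier (coord_ring X) \<Longrightarrow> b \<in> carrier (coord_ring X) \<Longrightarrow>
    \<phi> (\<lambda>x. a x * b x) = (\<lambda>y. \<phi> a y * \<phi> b y)"
  using iso by (auto simp: ring_iso_def ring_hom_def coord_ring_def inv_ring_def)

lemma hom_inj: "inj_on \<phi> (carrier (coord_ring X))"
  using iso by (auto simp: ring_iso_def bij_betw_def)

lemma hom_image_zero_outside:
  assumes "a \<in> carrier (coord_ring X)" "y \<notin> Y"
  shows "\<phi> a y = 0"
proof -
  have "\<phi> a \<in> inv_coord G Y act"
    using iso assms(1) by (auto simp: ring_iso_def ring_hom_def inv_ring_def)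
  then show ?thesis
    using assms(2) coord_le_zero_outside by (auto simp: inv_coord_def coord_ring_carrier)
qed

lemma transported_add:
  assumes "transported u v" "transported u' v'"
  shows "transported (\<lambda>x. u x + u' x) (\<lambda>y. v y + v' y)"
proof -
  obtain a b where "a \<in> carrier (coord_ring X)" "\<forall>x\<in>X. a x = u x" "\<forall>y\<in>Y. \<phi> a y = v y"
    "b \<in> carrier (coord_ring X)" "\<forall>x\<in>X. b x = u' x" "\<forall>y\<in>Y. \<phi> b y = v' y"
    using assms unfolding transported_def by blast
  then show ?thesis
    unfolding transported_def
    by (intro bexI[of _ "\<lambda>x. a x + b x"]) (simp_all add: hom_add coord_ring_add_closed)
qed

lemma transported_mult:
  assumes "transported u v" "transported u' v'"
  shows "transported (\<lambda>x. u x * u' x) (\<lambda>y. v y * v' y)"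
proof -
  obtain a b where "a \<in> carrier (coord_ring X)" "\<forall>x\<in>X. a x = u x" "\<forall>y\<in>Y. \<phi> a y = v y"
    "b \<in> carrier (coord_ring X)" "\<forall>x\<in>X. b x = u' x" "\<forall>y\<in>Y. \<phi> b y = v' y"
    using assms unfolding transported_def by blast
  then show ?thesis
    unfolding transported_def
    by (intro bexI[of _ "\<lambda>x. a x * b x"]) (simp_all add: hom_mult coord_ring_mult_closed)
qed

text \<open>A ring isomorphism need not be complex linear. Here constants go to constants because they
  are the elements of filtration degree 0, and to themselves because some point lifts.\<close>

lemma transported_const: "transported (\<lambda>x. c) (\<lambda>y. c)"
proof -
  let ?a = "restr X (\<lambda>x. c)"
  have a: "?a \<in> carrier (coord_ring X)"
    using coord_le_const coord_ring_carrier by blast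
  have "\<phi> ?a \<in> coord_le Y 0"
    using doubles coord_le_const[of X c 0] by (auto simp: doubles_filtration_def dest!: spec[of _ 0])
  then obtain P where P: "P \<in> poly_le 0" "\<phi> ?a = restr Y P"
    by (rule coord_leE)
  obtain c' where c': "P = (\<lambda>x. c')"
    using P(1) by (rule poly_le_0_constant)
  obtain x y where xy: "x \<in> S" "y \<in> Y" "\<phi> ?a y = ?a x"
    using S_nonempty lift a by (fastforce simp: points_lift_def)
  have "restr Y P y = restr X (\<lambda>x. c) x"
    using xy(3) by (simp only: P(2))
  then have "c' = c"
    using xy(1,2) S_subset by (auto simp: c' restr_def)
  then show ?thesis
    unfolding transported_def using a P(2) c' by (intro bexI[of _ ?a]) (auto simp: restr_def)
qed

lemma transported_sum:
  "(\<And>i. i \<in> I \<Longrightarrow> transported (u i) (v i)) \<Longrightarrow>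
    transported (\<lambda>x. \<Sum>i\<in>I. u i x) (\<lambda>y. \<Sum>i\<in>I. v i y)"
  by (induction I rule: infinite_finite_induct) (auto intro: transported_const transported_add)

lemma transported_prod:
  "(\<And>i. i \<in> I \<Longrightarrow> transported (u i) (v i)) \<Longrightarrow>
    transported (\<lambda>x. \<Prod>i\<in>I. u i x) (\<lambda>y. \<Prod>i\<in>I. v i y)"
  by (induction I rule: infinite_finite_induct) (auto intro: transported_const transported_mult)

text \<open>The Leibniz formula uses only sums, products and constants, all of which are
  transported.\<close>

lemma transported_det:
  fixes u :: "'i::finite \<Rightarrow> 'i \<Rightarrow> real ^ 'n \<Rightarrow> complex"
  assumes "\<And>i j. transported (u i j) (v i j)"
  shows "transported (\<lambda>x. det (\<chi> i j. u i j x)) (\<lambda>y. det (\<chi> i j. v i j y))"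
  unfolding det_def
  by (simp, intro transported_sum transported_mult transported_prod transported_const assms)

text \<open>\<open>\<phi>\<close> is injective and sends 0 to 0, and extension by zero makes an
  element zero once it vanishes on its variety. Identities thus pass between \<open>Y\<close> and
  all of \<open>X\<close>, including points that do not lift.\<close>

lemma transported_zero_iff:
  assumes "transported u v"
  shows "(\<forall>x\<in>X. u x = 0) \<longleftrightarrow> (\<forall>y\<in>Y. v y = 0)"
proof -
  obtain a where a: "a \<in> carrier (coord_ring X)" "\<And>x. x \<in> X \<Longrightarrow> a x = u x" "\<And>y. y \<in> Y \<Longrightarrow> \<phi> a y = v y"
    using assms by (auto simp: transported_def)
  have z: "(\<lambda>x. 0) \<in> carrier (coord_ring X)"
    using coord_le_zero coord_ring_carrier by blast
  have "\<phi> (\<lambda>x. 0) = (\<lambda>y. 0)"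
    using hom_add[OF z z] by (auto simp: fun_eq_iff)
  then have "a = (\<lambda>x. 0) \<longleftrightarrow> \<phi> a = (\<lambda>y. 0)"
    using inj_on_eq_iff[OF hom_inj a(1) z] by simp
  moreover have "a = (\<lambda>x. 0) \<longleftrightarrow> (\<forall>x\<in>X. u x = 0)"
  proof -
    have "a x = 0" if "x \<notin> X" for x
      using a(1) that coord_le_zero_outside unfolding coord_ring_carrier by blast
    then show ?thesis
      using a(2) by (metis (full_types))
  qed
  moreover have "\<phi> a = (\<lambda>y. 0) \<longleftrightarrow> (\<forall>y\<in>Y. v y = 0)"
    using a(3) hom_image_zero_outside[OF a(1)] by (metis (full_types))
  ultimately show ?thesis by blast
qed

text \<open>The difference corresponds to zero. Hence a choice of preimage is unique on
  \<open>X\<close> and inherits linearity from \<open>Y\<close>.\<close>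

lemma transported_cong_left:
  assumes "transported u v" "transported u' v" "x \<in> X"
  shows "u x = u' x"
proof -
  have "transported (\<lambda>x. u x + (- 1) * u' x) (\<lambda>y. v y + (- 1) * v y)"
    by (intro transported_add transported_mult transported_const assms)
  then show ?thesis
    using assms(3) transported_zero_iff by fastforce
qed

lemma transported_lift:
  assumes "x \<in> S"
  obtains y where "y \<in> Y" "\<And>u v. transported u v \<Longrightarrow> u x = v y"
proof -
  obtain y where y: "y \<in> Y" "\<And>a. a \<in> carrier (coord_ring X) \<Longrightarrow> \<phi> a y = a x"
    using lift assms unfolding points_lift_def by blast
  have "u x = v y" if "transported u v" for u v
    using that y S_subset assms unfolding transported_def by (metis subsetD)
  with y(1) show ?thesis by (rule that)
qed

text \<open>The product has degree at most \<open>2 * d\<close> on \<open>Y\<close>, and the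
  doubling of the filtration halves this on \<open>X\<close>.\<close>

lemma ex_transported_herm:
  assumes "unitary_rep G T \<rho>" "f \<in> inv_tensor_le G Y act \<rho> d" "g \<in> inv_tensor_le G Y act \<rho> d"
  shows "\<exists>P\<in>poly_le d. transported P (\<lambda>y. herm (f y) (g y))"
proof -
  have "(\<lambda>y. herm (f y) (g y)) \<in> \<phi> ` coord_le X d"
    using herm_inv_coord[OF assms] doubles by (simp add: doubles_filtration_def mult_2)
  then obtain a where a: "a \<in> coord_le X d" "\<phi> a = (\<lambda>y. herm (f y) (g y))"
    by auto
  obtain P where P: "P \<in> poly_le d" "a = restr X P"
    using a(1) by (rule coord_leE)
  have "transported P (\<lambda>y. herm (f y) (g y))"
    unfolding transported_def using a P by (intro bexI[of _ a]) (auto simp: restr_def coord_ring_carrier)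
  with P(1) show ?thesis by blast
qed

end


section \<open>The bound\<close>

theorem theorem5p2:
  fixes \<mu> :: "(real ^ 'n::finite) measure"
    and X :: "(real ^ 'n) set"
    and Y :: "(real ^ 'k::finite) set"
    and G :: "('g, 'm) monoid_scheme"
    and T :: "'g topology"
    and act :: "'g \<Rightarrow> real ^ 'k \<Rightarrow> real ^ 'k"
    and \<rho> :: "'g \<Rightarrow> complex ^ 'v ^ 'v::finite"
    and \<phi> :: "(real ^ 'n \<Rightarrow> complex) \<Rightarrow> (real ^ 'k \<Rightarrow> complex)"
    and F :: "(real ^ 'n) set"
    and w :: "real ^ 'n \<Rightarrow> real"
    and t :: nat
  assumes "normalized_measure_with_moments \<mu>"
    and "X = zariski_closure (measure_support \<mu>)"
    and "algebraic_set Y"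
    and "compact_group G T"
    and "algebraic_action G T Y act"
    and "\<phi> \<in> ring_iso (coord_ring X) (inv_ring G Y act)"
    and "doubles_filtration G X Y act \<phi>"
    and "points_lift (measure_support \<mu>) X Y \<phi>"
    and "unitary_rep G T \<rho>"
    and "cubature_formula t \<mu> F w"
    and "F \<subseteq> X"
  shows "real (card F) \<ge>
    real (fun_vec.dim (inv_tensor_le G Y act \<rho> t)) / real (vec.dim (UNIV :: (complex ^ 'v) set))"
proof -
  note \<mu> = assms(1) and X = assms(2) and \<rho> = assms(9) and cub = assms(10) and FX = assms(11)
  interpret filtered_invariant_iso "measure_support \<mu>" X Y G act \<phi>
  proof
    show "measure_support \<mu> \<subseteq> X"
      unfolding X by (rule zariski_closure_superset)
    show "measure_support \<mu> \<noteq> {}"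
      using \<mu> by (intro measure_support_nonempty) (auto simp: normalized_measure_with_moments_def)
  qed (rule assms)+
  define M where "M = inv_tensor_le G Y act \<rho> t"
  have sub: "fun_vec.subspace M"
    unfolding M_def by (rule subspace_inv_tensor_le)
  \<comment> \<open>The chosen polynomial is determined only on \<open>X\<close>, so the linearity
    facts below are confined to points of \<open>X\<close>.\<close>
  define Q where "Q f g = (SOME P. P \<in> poly_le t \<and> transported P (\<lambda>y. herm (f y) (g y)))"
    for f g :: "real ^ 'k \<Rightarrow> complex ^ 'v"
  have Q: "Q f g \<in> poly_le t" "transported (Q f g) (\<lambda>y. herm (f y) (g y))"
    if "f \<in> M" "g \<in> M" for f g
  proof -
    have "\<exists>P. P \<in> poly_le t \<and> transported P (\<lambda>y. herm (f y) (g y))"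
      using ex_transported_herm[OF \<rho> that[unfolded M_def]] by blast
    from someI_ex[OF this] show "Q f g \<in> poly_le t" "transported (Q f g) (\<lambda>y. herm (f y) (g y))"
      by (simp_all add: Q_def)
  qed
  have Q_add: "Q (f + f') g x = Q f g x + Q f' g x"
    if M: "f \<in> M" "f' \<in> M" "g \<in> M" and x: "x \<in> X" for f f' g x
  proof (rule transported_cong_left[OF _ _ x])
    show "transported (Q (f + f') g) (\<lambda>y. herm ((f + f') y) (g y))"
      by (rule Q(2)[OF fun_vec.subspace_add[OF sub M(1,2)] M(3)])
    show "transported (\<lambda>x. Q f g x + Q f' g x) (\<lambda>y. herm ((f + f') y) (g y))"
      using transported_add[OF Q(2)[OF M(1,3)] Q(2)[OF M(2,3)]] by (simp add: herm_add_left)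
  qed
  have Q_scale: "Q (fscale c f) g x = c * Q f g x"
    if M: "f \<in> M" "g \<in> M" and x: "x \<in> X" for c f g x
  proof (rule transported_cong_left[OF _ _ x])
    show "transported (Q (fscale c f) g) (\<lambda>y. herm (fscale c f y) (g y))"
      by (rule Q(2)[OF fun_vec.subspace_scale[OF sub M(1)] M(2)])
    show "transported (\<lambda>x. c * Q f g x) (\<lambda>y. herm (fscale c f y) (g y))"
      using transported_mult[OF transported_const[of c] Q(2)[OF M]]
      by (simp add: herm_scale_left fscale_def)
  qed

  have definite: "f = 0" if f: "f \<in> M" and vanish: "\<And>p. p \<in> F \<Longrightarrow> Q f f p = 0" for f
  proof -
    let ?P = "Q f f"
    \<comment> \<open>The cubature formula and the Zariski closure speak of real polynomials, so
      real and imaginary parts are treated separately.\<close>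
    have Re: "(\<lambda>x. Re (?P x)) \<in> poly_le t" and Im: "(\<lambda>x. Im (?P x)) \<in> poly_le t"
      using poly_le_linear[OF bounded_linear.linear[OF bounded_linear_Re] Q(1)[OF f f]]
        poly_le_linear[OF bounded_linear.linear[OF bounded_linear_Im] Q(1)[OF f f]]
      by simp_all
    \<comment> \<open>At a lifted point the value is a squared norm, hence real and
      nonnegative.\<close>
    have nonneg: "0 \<le> Re (?P x) \<and> Im (?P x) = 0" if x: "x \<in> measure_support \<mu>" for x
    proof -
      obtain y where "y \<in> Y" "?P x = herm (f y) (f y)"
        using transported_lift[OF x] Q(2)[OF f f] by metis
      then show ?thesis by (simp add: herm_self sum_nonneg)
    qed
    have "(LINT x|\<mu>. Re (?P x)) = (\<Sum>p\<in>F. w p * Re (?P p))"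
      using cub Re by (simp add: cubature_formula_def)
    also have "\<dots> = 0"
      using vanish by simp
    finally have Re_0: "Re (?P x) = 0" if "x \<in> measure_support \<mu>" for x
      using integral_eq_zero_imp_vanishes_on_support[OF \<mu> Re] nonneg that by blast
    have "?P x = 0" if "x \<in> X" for x
    proof (rule complex_eqI)
      show "Re (?P x) = Re 0"
        using poly_vanishes_on_zariski_closure[OF Re Re_0] that unfolding X by simp
      show "Im (?P x) = Im 0"
        using poly_vanishes_on_zariski_closure[OF Im, of "measure_support \<mu>" x] nonneg that
        unfolding X by simp
    qed
    then have "f y = 0" if "y \<in> Y" for y
      using transported_zero_iff[OF Q(2)[OF f f]] that by (simp add: herm_self_eq_0)
    moreover have "f y = 0" if "y \<notin> Y" for y
    proof -
      have "f \<in> tensor_vec (coord_le Y t)"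
        using f by (simp add: M_def inv_tensor_le_def)
      from coord_le_zero_outside[OF tensor_vec_component[OF this] that] show ?thesis
        by (simp add: vec_eq_iff)
    qed
    ultimately show ?thesis by (auto simp: fun_eq_iff)
  qed

  \<comment> \<open>At each node, pairing with the few elements of \<open>S p\<close> already
    decides whether \<open>f\<close> pairs to zero with all of \<open>M\<close>.\<close>
  have "\<forall>p\<in>F. \<exists>S. S \<subseteq> M \<and> finite S \<and> card S \<le> CARD('v) \<and>
    (\<forall>f\<in>M. (\<forall>g\<in>S. Q f g p = 0) \<longrightarrow> (\<forall>g\<in>M. Q f g p = 0))"
  proof (intro ballI finite_rank_of_vanishing_minors)
    fix p assume p: "p \<in> F"
    fix f g :: "'v option \<Rightarrow> real ^ 'k \<Rightarrow> complex ^ 'v"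
    assume "range f \<subseteq> M" "range g \<subseteq> M"
    then have "transported (\<lambda>x. det (\<chi> i j. Q (f i) (g j) x)) (\<lambda>y. det (\<chi> i j. herm (f i y) (g j y)))"
      by (intro transported_det Q) auto
    from transported_zero_iff[OF this] have "\<forall>x\<in>X. det (\<chi> i j. Q (f i) (g j) x) = 0"
      by (simp add: det_herm_eq_0)
    then show "det (\<chi> i j. Q (f i) (g j) p) = 0"
      using p FX by blast
  qed
  from bchoice[OF this] obtain S where S: "\<forall>p\<in>F. S p \<subseteq> M \<and> finite (S p) \<and> card (S p) \<le> CARD('v) \<and>
      (\<forall>f\<in>M. (\<forall>g\<in>S p. Q f g p = 0) \<longrightarrow> (\<forall>g\<in>M. Q f g p = 0))"
    by blast
  have finF: "finite F"
    using cub by (simp add: cubature_formula_def)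
  \<comment> \<open>A pair of a node \<open>p\<close> and some \<open>g\<close> in
    \<open>S p\<close> indexes the functional sending \<open>f\<close> to
    \<open>Q f g p\<close>.\<close>
  let ?J = "Sigma F S"
  have J: "fst j \<in> X" "snd j \<in> M" if "j \<in> ?J" for j
  proof -
    have "fst j \<in> F" "snd j \<in> S (fst j)"
      using that by auto
    then show "fst j \<in> X" "snd j \<in> M"
      using S FX by blast+
  qed
  \<comment> \<open>The finite spanning set also shows that \<open>M\<close> is finite-dimensional,
    so its \<open>dim\<close> is a genuine dimension and not the default value 0.\<close>
  have "\<exists>B. finite B \<and> card B \<le> card ?J \<and> M \<subseteq> fun_vec.span B"
  proof (rule fun_vec.spanned_by_card_separating_functionals[OF _ sub,
        where l = "\<lambda>j f. Q f (snd j) (fst j)"])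
    show "finite ?J" using finF S by blast
  next
    fix j f f' assume "j \<in> ?J" "f \<in> M" "f' \<in> M"
    then show "Q (f + f') (snd j) (fst j) = Q f (snd j) (fst j) + Q f' (snd j) (fst j)"
      using J by (intro Q_add) auto
  next
    fix j c f assume "j \<in> ?J" "f \<in> M"
    then show "Q (fscale c f) (snd j) (fst j) = c * Q f (snd j) (fst j)"
      using J by (intro Q_scale) auto
  next
    fix f assume f: "f \<in> M" and vanish: "\<And>j. j \<in> ?J \<Longrightarrow> Q f (snd j) (fst j) = 0"
    show "f = 0"
    proof (rule definite[OF f])
      fix p assume p: "p \<in> F"
      then have "\<forall>g\<in>S p. Q f g p = 0"
        using vanish by force
      \<comment> \<open>Vanishing against \<open>S p\<close> extends to every element of
        \<open>M\<close>, in particular to \<open>f\<close> itself.\<close>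
      then show "Q f f p = 0"
        using S p f by blast
    qed
  qed
  then have "fun_vec.dim M \<le> card ?J"
    using fun_vec.dim_le_card order_trans by blast
  also have "\<dots> = (\<Sum>p\<in>F. card (S p))"
    using finF S by (simp add: card_SigmaI)
  also have "\<dots> \<le> card F * CARD('v)"
    using sum_bounded_above[of F "\<lambda>p. card (S p)" "CARD('v)"] S by simp
  finally have "real (fun_vec.dim M) \<le> real (card F) * real CARD('v)"
    by (simp flip: of_nat_mult)
  then show ?thesis
    unfolding M_def vec_dim_card by (simp add: divide_le_eq)
qed

end
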